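(* Let $\varphi$ be a strongly convex function, and let $\gamma$ be a concave function on $\mathbb R$, strictly increasing to infinity, such that $$\limsup_{t\to\infty}\frac{\varphi(t+\gamma(t))}{\varphi(t)}=+\infty .$$ Put $\Phi=\varphi\circ\log$ and $\Psi_\gamma=\varphi\circ\gamma^{-1}\circ\log$. Then there exists $g\in\mathcal H_{\Psi_\gamma}$ such that $g\notin\operatorname{Mult}(\mathcal H_\Phi)$.
   Context: $\mathbb D$ is the open unit disk, $\mathbb T=\partial\mathbb D$ with normalized Lebesgue measure $m$, $\operatorname{Hol}(\mathbb D)$ is the space of holomorphic functions on $\mathbb D$, and $N^+$ is the Smirnov class on $\mathbb D$; functions in $N^+$ have non-tangential boundary values a.e. on $\mathbb T$, denoted by the same letter. A function $\varphi:\mathbb R\to[0,\infty)$ is strongly convex if it is convex, nondecreasing and $\lim_{t\to\infty}\varphi(t)/t=\infty$; one sets $\varphi(-\infty)=0$. For a nondecreasing $\Phi:[0,\infty)\to[0,\infty)$, the Hardy-Orlicz class is $\mathcal H_\Phi=\{f\in N^+:\int_{\mathbb T}\Phi(|f|)\,dm<\infty\}$. For $X\subset\operatorname{Hol}(\mathbb D)$, $\operatorname{Mult}(X)=\{g\in\operatorname{Hol}(\mathbb D): gf\in X \text{ for all } f\in X\}$. *)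

theory Defs
  imports "HOL-Complex_Analysis.Complex_Analysis"
begin

(* Functions on the unit disk are represented by total functions complex => complex;
   every notion below depends only on their values on ball 0 1. *)

definition circle_measure :: "complex measure" where
  "circle_measure = distr (uniform_measure lborel {0..<2 * pi}) borel cis"

definition stolz_region :: "real \<Rightarrow> complex \<Rightarrow> complex set" where
  "stolz_region \<alpha> \<zeta> = {z \<in> ball 0 1. dist z \<zeta> < \<alpha> * (1 - norm z)}"

definition has_nontangential_limit :: "(complex \<Rightarrow> complex) \<Rightarrow> complex \<Rightarrow> complex \<Rightarrow> bool" where
  "has_nontangential_limit f L \<zeta> \<longleftrightarrow>
     (\<forall>\<alpha>>1. (f \<longlongrightarrow> L) (at \<zeta> within stolz_region \<alpha> \<zeta>))"

(* Unspecified at points without a nontangential limit; for functions of the Nevanlinna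
   class these form a null set. *)
definition boundary_value :: "(complex \<Rightarrow> complex) \<Rightarrow> complex \<Rightarrow> complex" where
  "boundary_value f \<zeta> = (THE L. has_nontangential_limit f L \<zeta>)"

(* ln 0 = 0 in HOL, so log_plus 0 = 0 as required. *)
definition log_plus :: "real \<Rightarrow> real" where
  "log_plus x = max 0 (ln x)"

definition nevanlinna_class :: "(complex \<Rightarrow> complex) set" where
  "nevanlinna_class = {f. f holomorphic_on ball 0 1 \<and>
     (SUP r\<in>{0..<1}. \<integral>\<^sup>+ \<zeta>. ennreal (log_plus (norm (f (of_real r * \<zeta>)))) \<partial>circle_measure) < \<infinity>}"

(* The definition of Duren, Theory of H^p Spaces, Section 2.5. *)
definition smirnov_class :: "(complex \<Rightarrow> complex) set" where
  "smirnov_class = {f \<in> nevanlinna_class.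
     ((\<lambda>r. \<integral>\<^sup>+ \<zeta>. ennreal (log_plus (norm (f (of_real r * \<zeta>)))) \<partial>circle_measure)
       \<longlongrightarrow> (\<integral>\<^sup>+ \<zeta>. ennreal (log_plus (norm (boundary_value f \<zeta>))) \<partial>circle_measure)) (at_left (1::real))}"

definition strongly_convex :: "(real \<Rightarrow> real) \<Rightarrow> bool" where
  "strongly_convex \<phi> \<longleftrightarrow> (\<forall>t. 0 \<le> \<phi> t) \<and> convex_on UNIV \<phi> \<and> mono \<phi> \<and>
     filterlim (\<lambda>t. \<phi> t / t) at_top at_top"

(* The composition of \<phi> with log on the half-line [0, \<infinity>), where log 0 = -\<infinity>
   and \<phi> is given the value 0 at -\<infinity>. *)
definition comp_log :: "(real \<Rightarrow> real) \<Rightarrow> real \<Rightarrow> real" where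
  "comp_log \<phi> x = (if x \<le> 0 then 0 else \<phi> (ln x))"

definition hardy_orlicz :: "(real \<Rightarrow> real) \<Rightarrow> (complex \<Rightarrow> complex) set" where
  "hardy_orlicz \<Phi> = {f \<in> smirnov_class.
     (\<integral>\<^sup>+ \<zeta>. ennreal (\<Phi> (norm (boundary_value f \<zeta>))) \<partial>circle_measure) < \<infinity>}"

definition multipliers :: "(complex \<Rightarrow> complex) set \<Rightarrow> (complex \<Rightarrow> complex) set" where
  "multipliers X = {g. g holomorphic_on ball 0 1 \<and> (\<forall>f\<in>X. (\<lambda>z. g z * f z) \<in> X)}"

end

theory Submission
  imports Defs
begin

text \<open>
  Choose \<open>t n\<close> large with \<open>\<phi> (t n + \<gamma> (t n)) > 2 ^ (n + 1) * \<phi> (t n)\<close> and split the circle into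
  arcs \<open>E n\<close> of measure \<open>m n\<close> proportional to \<open>1 / (2 ^ (n + 1) * \<phi> (t n))\<close>. Let \<open>f\<close> and \<open>g\<close> be
  outer functions with \<open>\<bar>f\<bar> = exp (t n)\<close> and \<open>\<bar>g\<bar> = exp (\<gamma> (t n))\<close> on \<open>E n\<close>. The integrals of
  \<open>\<Phi>(\<bar>f\<bar>)\<close> and \<open>\<Psi>\<^sub>\<gamma>(\<bar>g\<bar>)\<close> both equal the sum of \<open>\<phi> (t n) * m n\<close>, a convergent geometric series,
  while \<open>\<Phi>(\<bar>f g\<bar>)\<close> has integral at least the sum of \<open>2 ^ (n + 1) * \<phi> (t n) * m n\<close>,
  whose terms are constant.
  Since the boundary data are locally constant off a countable set, the boundary values can be
  read off from the Herglotz integral directly, without Fatou's theorem.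
\<close>

section \<open>Normalized Lebesgue measure on the unit circle\<close>

lemma sets_circle_measure [simp, measurable_cong]: "sets circle_measure = sets borel"
  by (simp add: circle_measure_def)

lemma space_circle_measure [simp]: "space circle_measure = UNIV"
  by (simp add: circle_measure_def)

lemma cis_borel_measurable [measurable]: "cis \<in> borel_measurable borel"
  by (intro borel_measurable_continuous_onI continuous_intros)

lemma emeasure_circle_measure:
  assumes [measurable]: "A \<in> sets borel"
  shows "emeasure circle_measure A = emeasure lborel ({0..<2 * pi} \<inter> cis -` A) / ennreal (2 * pi)"
proof -
  have "cis -` A \<in> sets lborel"
    using measurable_sets[OF cis_borel_measurable assms] by simp
  then show ?thesis
    unfolding circle_measure_def by (subst emeasure_distr) auto
qed

interpretation circle_measure: finite_measure circle_measure
  by standard (simp add: emeasure_circle_measure ennreal_divide_eq_top_iff)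

lemma AE_circle_measure_norm: "AE \<zeta> in circle_measure. norm \<zeta> = 1"
  unfolding circle_measure_def by (subst AE_distr_iff) auto

lemma Arg2pi_cis: "0 \<le> t \<Longrightarrow> t < 2 * pi \<Longrightarrow> Arg2pi (cis t) = t"
  using Arg2pi_exp[of "\<i> * of_real t"] by (simp add: cis_conv_exp)

lemma Arg2pi_borel_measurable [measurable]: "Arg2pi \<in> borel_measurable borel"
  by (auto simp: borel_measurable_iff_greater intro!: borel_open open_Arg2pi2pi_gt)

text \<open>\<open>Arg2pi\<close> inverts \<open>cis\<close> on the parameter interval, so only
  countably many angles can land in \<open>N\<close>, and these form a Lebesgue null set.\<close>

lemma AE_circle_measure_not_in_countable:
  assumes "countable N"
  shows "AE \<zeta> in circle_measure. \<zeta> \<notin> N"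
proof (rule AE_not_in)
  have [measurable]: "N \<in> sets borel"
    using assms by (simp add: sets.countable)
  have "{0..<2 * pi} \<inter> cis -` N \<subseteq> Arg2pi ` N"
    using Arg2pi_cis by force
  then have "countable ({0..<2 * pi} \<inter> cis -` N)"
    by (rule countable_subset) (intro countable_image assms)
  then have "emeasure circle_measure N = 0"
    by (simp add: emeasure_circle_measure emeasure_lborel_countable)
  then show "N \<in> null_sets circle_measure"
    by auto
qed

text \<open>The mean value property, obtained from Cauchy's formula at the centre and transported to
  the image measure. Borel measurability is a separate hypothesis because holomorphy says nothing
  outside the ball.\<close>

lemma integral_circle_measure_holomorphic:
  fixes g :: "complex \<Rightarrow> complex"
  assumes [measurable]: "g \<in> borel_measurable borel"
    and hol: "g holomorphic_on ball 0 R" and r: "0 \<le> r" "r < R"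
  shows "integrable circle_measure (\<lambda>\<zeta>. g (of_real r * \<zeta>))"
    and "(LINT \<zeta>|circle_measure. g (of_real r * \<zeta>)) = g 0"
proof -
  have cont: "continuous_on (cball 0 r) g"
    using hol r by (intro continuous_on_subset[OF holomorphic_on_imp_continuous_on[OF hol]]) auto
  then have "bounded (g ` cball 0 r)"
    by (intro compact_imp_bounded compact_continuous_image) auto
  then obtain B where B: "\<And>z. norm z \<le> r \<Longrightarrow> norm (g z) \<le> B"
    unfolding bounded_iff by fastforce
  have *: "norm (of_real r * \<zeta>) \<le> r" if "norm \<zeta> = 1" for \<zeta> :: complex
    using r that by (simp add: norm_mult)
  show int: "integrable circle_measure (\<lambda>\<zeta>. g (of_real r * \<zeta>))"
    using AE_circle_measure_norm
    by (intro circle_measure.integrable_const_bound[of _ B]) (auto elim!: eventually_mono intro!: B *)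
  let ?I = "\<lambda>t. g (of_real r * cis t)"
  \<comment> \<open>For positive radius, the derivative \<open>r * \<i> * cis t\<close> of the path
    cancels the denominator of the Cauchy integrand up to the factor \<open>\<i>\<close>. For radius
    0 the path degenerates and the integrand is constant.\<close>
  have int_I: "(?I has_integral (2 * pi * g 0)) {0..2*pi}"
  proof (cases "r = 0")
    case True
    then show ?thesis
      using has_integral_const_real[of "g 0" 0 "2 * pi"] by (simp add: scaleR_conv_of_real)
  next
    case False
    have "((\<lambda>u. g u / (u - 0)) has_contour_integral (2 * of_real pi * \<i> * g 0)) (circlepath 0 r)"
      using False r cont hol
      by (intro Cauchy_integral_circlepath) auto
    then have "((\<lambda>t. g (0 + r * cis t) / (0 + r * cis t - 0) * r * \<i> * cis t) has_integral
        (2 * of_real pi * \<i> * g 0)) {0..2*pi}"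
      unfolding circlepath_def by (subst (asm) has_contour_integral_part_circlepath_iff) auto
    then have "((\<lambda>t. ?I t * \<i>) has_integral (2 * of_real pi * \<i> * g 0)) {0..2*pi}"
      using False by (simp add: field_simps)
    from has_integral_mult_left[OF this, of "-\<i>"] show ?thesis
      by (simp add: mult_ac)
  qed
  have "continuous_on {0..2*pi} ?I"
    using r by (intro continuous_on_compose2[OF cont] continuous_intros) (auto simp: norm_mult)
  then have sint: "set_integrable lborel {0..2*pi} ?I"
    by (intro borel_integrable_atLeastAtMost')
  have "(LINT \<zeta>|circle_measure. g (of_real r * \<zeta>)) = (LINT t|uniform_measure lborel {0..<2*pi}. ?I t)"
    unfolding circle_measure_def by (subst integral_distr) auto
  also have "uniform_measure lborel {0..<2*pi} =
      density lborel (\<lambda>t. ennreal (indicator {0..<2*pi} t / (2 * pi)))"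
    unfolding uniform_measure_def
    by (auto intro!: arg_cong[where f = "density lborel"] simp: fun_eq_iff indicator_def
        simp flip: ennreal_1 ennreal_0 divide_ennreal)
  also have "(LINT t|\<dots>. ?I t) = (LINT t|lborel. (indicator {0..<2*pi} t / (2 * pi)) *\<^sub>R ?I t)"
    by (subst integral_density) auto
  \<comment> \<open>The half-open and closed intervals differ by the null set consisting of the
    point \<open>2 * pi\<close>.\<close>
  also have "\<dots> = (LINT t|lborel. (1 / (2 * pi)) *\<^sub>R indicator {0..2*pi} t *\<^sub>R ?I t)"
    by (intro integral_cong_AE) (auto intro!: eventually_mono[OF AE_lborel_singleton[of "2 * pi"]]
        split: split_indicator)
  also have "\<dots> = (1 / (2 * pi)) *\<^sub>R (LINT t:{0..2*pi}|lborel. ?I t)"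
    unfolding set_lebesgue_integral_def by (rule integral_scaleR_right)
  also have "(LINT t:{0..2*pi}|lborel. ?I t) = 2 * pi * g 0"
    using set_borel_integral_eq_integral(2)[OF sint] int_I by (simp add: integral_unique)
  finally show "(LINT \<zeta>|circle_measure. g (of_real r * \<zeta>)) = g 0"
    by (simp add: scaleR_conv_of_real)
qed

subsection \<open>The Herglotz integral\<close>

text \<open>For \<open>\<zeta>\<close> on the circle, the real part is the Poisson kernel; the
  imaginary part makes the kernel holomorphic in \<open>z\<close>.\<close>

definition herglotz_kernel :: "complex \<Rightarrow> complex \<Rightarrow> complex" where
  "herglotz_kernel \<zeta> z = (\<zeta> + z) / (\<zeta> - z)"

definition herglotz :: "(complex \<Rightarrow> real) \<Rightarrow> complex \<Rightarrow> complex" where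
  "herglotz u z = (LINT \<zeta>|circle_measure. herglotz_kernel \<zeta> z * of_real (u \<zeta>))"

text \<open>The classical outer function with boundary modulus \<open>exp u\<close>: its log modulus
  in the disk is the Poisson integral of \<open>u\<close>.\<close>

definition outer_function :: "(complex \<Rightarrow> real) \<Rightarrow> complex \<Rightarrow> complex" where
  "outer_function u z = exp (herglotz u z)"

lemma herglotz_kernel_measurable [measurable]:
  "(\<lambda>\<zeta>. herglotz_kernel \<zeta> z) \<in> borel_measurable borel"
  unfolding herglotz_kernel_def by measurable

text \<open>The integrand is jointly measurable in both variables. Measurability on the whole plane
  is what the mean value property asks for when it is applied to \<open>herglotz u\<close>.\<close>

lemma herglotz_measurable [measurable]:
  assumes [measurable]: "u \<in> borel_measurable borel"
  shows "herglotz u \<in> borel_measurable borel"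
proof -
  have [measurable]: "(\<lambda>(z, \<zeta>). herglotz_kernel \<zeta> z * of_real (u \<zeta>)) \<in> borel_measurable (borel \<Otimes>\<^sub>M circle_measure)"
    unfolding herglotz_kernel_def by measurable
  show ?thesis
    unfolding herglotz_def by measurable
qed

lemma norm_herglotz_kernel_le:
  assumes "norm \<zeta> = 1" "norm z \<le> 1" "\<delta> > 0" "\<delta> \<le> norm (\<zeta> - z)"
  shows "norm (herglotz_kernel \<zeta> z) \<le> 2 / \<delta>"
proof -
  have "norm (\<zeta> + z) \<le> 2"
    using norm_triangle_ineq[of \<zeta> z] assms by simp
  then show ?thesis
    using assms by (simp add: herglotz_kernel_def norm_divide frac_le)
qed

lemma norm_herglotz_kernel_le':
  assumes "norm \<zeta> = 1" "norm z < 1"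
  shows "norm (herglotz_kernel \<zeta> z) \<le> 2 / (1 - norm z)"
  using assms norm_triangle_ineq2[of \<zeta> z] by (intro norm_herglotz_kernel_le) auto

text \<open>Besides positivity inside the disk, this yields real part 0 when \<open>z\<close> is
  itself on the circle, which later identifies the real part of boundary limits.\<close>

lemma Re_herglotz_kernel:
  assumes "norm \<zeta> = 1"
  shows "Re (herglotz_kernel \<zeta> z) = (1 - (norm z)\<^sup>2) / (norm (\<zeta> - z))\<^sup>2"
proof -
  have "(\<zeta> + z) / (\<zeta> - z) = (\<zeta> + z) * cnj (\<zeta> - z) / of_real ((norm (\<zeta> - z))\<^sup>2)"
    by (metis complex_div_cnj)
  moreover have "Re ((\<zeta> + z) * cnj (\<zeta> - z)) = 1 - (norm z)\<^sup>2"
    using assms cmod_power2[of \<zeta>] cmod_power2[of z] by (simp add: algebra_simps power2_eq_square)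
  ultimately show ?thesis
    unfolding herglotz_kernel_def by (simp only: Re_divide_of_real)
qed

lemma integrable_herglotz_kernel:
  assumes [measurable]: "u \<in> borel_measurable borel" and u: "integrable circle_measure u"
    and z: "norm z < 1"
  shows "integrable circle_measure (\<lambda>\<zeta>. herglotz_kernel \<zeta> z * of_real (u \<zeta>))"
proof (rule Bochner_Integration.integrable_bound)
  show "integrable circle_measure (\<lambda>\<zeta>. 2 / (1 - norm z) * u \<zeta>)"
    using u by simp
  show "AE \<zeta> in circle_measure. norm (herglotz_kernel \<zeta> z * of_real (u \<zeta>)) \<le> norm (2 / (1 - norm z) * u \<zeta>)"
    using AE_circle_measure_norm
  proof eventually_elim
    case (elim \<zeta>)
    then show ?case
      using norm_herglotz_kernel_le'[OF elim z] z
      unfolding norm_mult by (intro mult_mono) auto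
  qed
qed simp

lemma integral_herglotz_kernel:
  assumes z: "norm z < 1"
  shows "(LINT \<zeta>|circle_measure. herglotz_kernel \<zeta> z) = 1"
proof -
  \<comment> \<open>On the circle the kernel is the conjugate of \<open>F\<close>, which is holomorphic beyond the closed disk.\<close>
  define F where "F \<zeta> = (1 + cnj z * \<zeta>) / (1 - cnj z * \<zeta>)" for \<zeta>
  \<comment> \<open>The only pole of \<open>F\<close> has modulus \<open>1 / norm z\<close>. For
    \<open>z = 0\<close> the function is constant and any radius above 1 will do.\<close>
  define R where "R = (if z = 0 then 2 else 1 / norm z)"
  have R: "R > 1"
    using z by (auto simp: R_def)
  have nz: "1 - cnj z * \<zeta> \<noteq> 0" if "norm \<zeta> < R" for \<zeta>
  proof
    assume "1 - cnj z * \<zeta> = 0"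
    then have "norm (cnj z * \<zeta>) = 1"
      by (metis eq_iff_diff_eq_0 norm_one)
    then show False
      using that by (auto simp: R_def norm_mult field_simps split: if_splits)
  qed
  have "F holomorphic_on ball 0 R"
    unfolding F_def using nz by (intro holomorphic_intros) auto
  moreover have [measurable]: "F \<in> borel_measurable borel"
    unfolding F_def by measurable
  ultimately have "(LINT \<zeta>|circle_measure. F (of_real 1 * \<zeta>)) = F 0"
    using R by (intro integral_circle_measure_holomorphic(2)) auto
  then have *: "(LINT \<zeta>|circle_measure. F \<zeta>) = 1"
    by (simp add: F_def)
  have [measurable]: "(\<lambda>\<zeta>. cnj (F \<zeta>)) \<in> borel_measurable borel"
    by (rule measurable_compose[OF _ borel_measurable_continuous_onI]) (auto intro: continuous_intros)
  have "(LINT \<zeta>|circle_measure. herglotz_kernel \<zeta> z) = (LINT \<zeta>|circle_measure. cnj (F \<zeta>))"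
  proof (rule integral_cong_AE)
    show "AE \<zeta> in circle_measure. herglotz_kernel \<zeta> z = cnj (F \<zeta>)"
      using AE_circle_measure_norm
    proof eventually_elim
      case (elim \<zeta>)
      then have [simp]: "\<zeta> \<noteq> 0" and c: "cnj \<zeta> = 1 / \<zeta>"
        by (auto simp: divide_conv_cnj)
      show ?case
        using mult_divide_mult_cancel_left[of \<zeta> "1 + z / \<zeta>" "1 - z / \<zeta>"]
        by (simp add: F_def herglotz_kernel_def c distrib_left right_diff_distrib)
    qed
  qed simp_all
  then show ?thesis
    using * by simp
qed

text \<open>On the circle the kernel is \<open>2 / (1 - q) - 1\<close> with
  \<open>q = z / \<zeta>\<close>, hence 1 plus twice a geometric series without its constant term.
  Integrating term by term gives a power series in \<open>z\<close> with coefficients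
  \<open>a n\<close>.\<close>

lemma herglotz_holomorphic:
  assumes [measurable]: "u \<in> borel_measurable borel" and u: "integrable circle_measure u"
  shows "herglotz u holomorphic_on ball 0 1"
proof -
  define a where "a n = (if n = 0 then 1 else 2) * (LINT \<zeta>|circle_measure. inverse \<zeta> ^ n * of_real (u \<zeta>))" for n :: nat
  define s where "s z n \<zeta> = (if n = 0 then 1 else 2) * (z * inverse \<zeta>) ^ n * of_real (u \<zeta>)"
    for n :: nat and z \<zeta> :: complex
  have "(\<lambda>n. a n * (w - 0) ^ n) sums herglotz u w" if w: "w \<in> ball 0 1" for w
  proof -
    have w': "norm w < 1"
      using w by simp
    have bnd: "norm (s w n \<zeta>) \<le> 2 * norm w ^ n * \<bar>u \<zeta>\<bar>" if "norm \<zeta> = 1" for n \<zeta>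
      using that by (auto simp: s_def norm_mult norm_power norm_inverse mult_right_mono)
    have [measurable]: "s w n \<in> borel_measurable borel" for n
      unfolding s_def by measurable
    have maj: "integrable circle_measure (\<lambda>\<zeta>. 2 * norm w ^ n * \<bar>u \<zeta>\<bar>)" for n
      using u by simp
    have int: "integrable circle_measure (s w n)" for n
      using AE_circle_measure_norm
      by (intro Bochner_Integration.integrable_bound[OF maj[of n]]) (auto elim!: eventually_mono dest: bnd)
    have sums: "(\<lambda>n. s w n \<zeta>) sums (herglotz_kernel \<zeta> w * of_real (u \<zeta>))" if "norm \<zeta> = 1" for \<zeta>
    proof -
      define q where "q = w * inverse \<zeta>"
      have q: "norm q < 1"
        using that w' by (simp add: q_def norm_mult norm_inverse)
      have "\<zeta> \<noteq> 0"
        using that by auto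
      then have k: "herglotz_kernel \<zeta> w = 2 * (1 / (1 - q)) - 1"
      proof -
        have "1 - q \<noteq> 0"
          using q by auto
        moreover have "w = q * \<zeta>"
          using \<open>\<zeta> \<noteq> 0\<close> by (simp add: q_def)
        ultimately show ?thesis
          using \<open>\<zeta> \<noteq> 0\<close> unfolding herglotz_kernel_def
          by (auto simp: divide_simps) (auto simp: algebra_simps)
      qed
      have "(\<lambda>n. 2 * q ^ n - (if n = 0 then 1 else 0)) sums (2 * (1 / (1 - q)) - 1)"
        using sums_single[of 0 "\<lambda>_. 1::complex"]
        by (intro sums_diff sums_mult geometric_sums q) (simp add: eq_commute)
      from sums_mult2[OF this, of "of_real (u \<zeta>)"] show ?thesis
        unfolding k by (rule sums_cong[THEN iffD1, rotated]) (auto simp: s_def q_def)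
    qed
    have sm: "summable (\<lambda>n. norm (s w n \<zeta>))" if "norm \<zeta> = 1" for \<zeta>
    proof (rule summable_comparison_test')
      show "summable (\<lambda>n. 2 * norm w ^ n * \<bar>u \<zeta>\<bar>)"
        using w' by (intro summable_mult2 summable_mult[OF summable_geometric]) auto
    qed (simp add: bnd that)
    have sI: "summable (\<lambda>n. LINT \<zeta>|circle_measure. norm (s w n \<zeta>))"
    proof (rule summable_comparison_test')
      show "summable (\<lambda>n. 2 * norm w ^ n * (LINT \<zeta>|circle_measure. \<bar>u \<zeta>\<bar>))"
        using w' by (intro summable_mult2 summable_mult[OF summable_geometric]) auto
      fix n
      have "(LINT \<zeta>|circle_measure. norm (s w n \<zeta>)) \<le> (LINT \<zeta>|circle_measure. 2 * norm w ^ n * \<bar>u \<zeta>\<bar>)"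
        using AE_circle_measure_norm
        by (intro integral_mono_AE maj integrable_norm int) (auto elim!: eventually_mono dest: bnd)
      then show "norm (LINT \<zeta>|circle_measure. norm (s w n \<zeta>)) \<le> 2 * norm w ^ n * (LINT \<zeta>|circle_measure. \<bar>u \<zeta>\<bar>)"
        by simp
    qed
    have "(\<lambda>n. LINT \<zeta>|circle_measure. s w n \<zeta>) sums (LINT \<zeta>|circle_measure. (\<Sum>n. s w n \<zeta>))"
      using AE_circle_measure_norm
      by (intro sums_integral int sI) (auto elim!: eventually_mono dest: sm)
    also have "(LINT \<zeta>|circle_measure. (\<Sum>n. s w n \<zeta>)) = herglotz u w"
      unfolding herglotz_def using AE_circle_measure_norm
      by (intro integral_cong_AE) (auto elim!: eventually_mono dest!: sums sums_unique[symmetric])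
    also have "(\<lambda>n. LINT \<zeta>|circle_measure. s w n \<zeta>) = (\<lambda>n. a n * (w - 0) ^ n)"
    proof
      fix n
      have "s w n = (\<lambda>\<zeta>. ((if n = 0 then 1 else 2) * w ^ n) * (inverse \<zeta> ^ n * of_real (u \<zeta>)))"
        by (auto simp: s_def power_mult_distrib)
      then show "(LINT \<zeta>|circle_measure. s w n \<zeta>) = a n * (w - 0) ^ n"
        by (simp add: a_def)
    qed
    finally show ?thesis .
  qed
  then show ?thesis
    by (rule power_series_holomorphic)
qed

subsection \<open>Boundary behaviour of outer functions\<close>

text \<open>The codomain is left open so that the property can be proved for a labelling of arcs by
  natural numbers and then passed to real-valued step functions.\<close>

definition locally_const_at :: "(complex \<Rightarrow> 'a) \<Rightarrow> complex \<Rightarrow> bool" where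
  "locally_const_at u \<zeta> \<longleftrightarrow> (\<exists>\<delta>>0. \<forall>\<eta>. norm \<eta> = 1 \<and> dist \<eta> \<zeta> < \<delta> \<longrightarrow> u \<eta> = u \<zeta>)"

lemma locally_const_at_comp: "locally_const_at u \<zeta> \<Longrightarrow> locally_const_at (\<lambda>\<eta>. f (u \<eta>)) \<zeta>"
  unfolding locally_const_at_def by metis

lemma Re_herglotz:
  assumes [measurable]: "u \<in> borel_measurable borel" and u: "integrable circle_measure u"
    and z: "norm z < 1"
  shows "Re (herglotz u z) = (LINT \<zeta>|circle_measure. Re (herglotz_kernel \<zeta> z) * u \<zeta>)"
proof -
  have "Re (herglotz u z) = (LINT \<zeta>|circle_measure. Re (herglotz_kernel \<zeta> z * of_real (u \<zeta>)))"
    unfolding herglotz_def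
    by (rule integral_bounded_linear[symmetric, OF bounded_linear_Re integrable_herglotz_kernel]) (use assms in auto)
  then show ?thesis
    by simp
qed

lemma Re_herglotz_nonneg:
  assumes "u \<in> borel_measurable borel" "integrable circle_measure u" "\<And>\<zeta>. 0 \<le> u \<zeta>"
    and z: "norm z < 1"
  shows "0 \<le> Re (herglotz u z)"
  unfolding Re_herglotz[OF assms(1,2) z]
proof (rule integral_nonneg_AE)
  have "(norm z)\<^sup>2 \<le> 1"
    using z by (simp add: power_le_one)
  then show "AE \<zeta> in circle_measure. 0 \<le> Re (herglotz_kernel \<zeta> z) * u \<zeta>"
    using AE_circle_measure_norm assms(3) by (auto elim!: eventually_mono simp: Re_herglotz_kernel)
qed

lemma herglotz_0:
  assumes [measurable]: "u \<in> borel_measurable borel"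
  shows "herglotz u 0 = of_real (LINT \<zeta>|circle_measure. u \<zeta>)"
proof -
  have "herglotz u 0 = (LINT \<zeta>|circle_measure. of_real (u \<zeta>))"
    unfolding herglotz_def
  proof (rule integral_cong_AE)
    show "AE \<zeta> in circle_measure. herglotz_kernel \<zeta> 0 * of_real (u \<zeta>) = of_real (u \<zeta>)"
      using AE_circle_measure_norm by eventually_elim (auto simp: herglotz_kernel_def)
  qed simp_all
  then show ?thesis
    by simp
qed

text \<open>The approach to \<open>\<zeta>\<close> is through the whole disk, so the limit restricts
  to every Stolz region at once.\<close>

lemma herglotz_tendsto:
  assumes [measurable]: "u \<in> borel_measurable borel" and u: "integrable circle_measure u"
    and \<zeta>: "norm \<zeta> = 1" and "locally_const_at u \<zeta>"
  shows "\<exists>L. Re L = u \<zeta> \<and> (herglotz u \<longlongrightarrow> L) (at \<zeta> within ball 0 1)"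
proof -
  obtain \<delta> where \<delta>: "\<delta> > 0" "\<And>\<eta>. norm \<eta> = 1 \<Longrightarrow> dist \<eta> \<zeta> < \<delta> \<Longrightarrow> u \<eta> = u \<zeta>"
    using assms(4) by (auto simp: locally_const_at_def)
  \<comment> \<open>Subtracting the constant \<open>u \<zeta>\<close> removes the singularity of the kernel: \<open>v\<close> vanishes near \<open>\<zeta>\<close>.\<close>
  define v where "v \<eta> = u \<eta> - u \<zeta>" for \<eta>
  have [measurable]: "v \<in> borel_measurable borel"
    unfolding v_def by measurable
  have v: "integrable circle_measure v"
    unfolding v_def using u by simp
  have v0: "v \<eta> = 0" if "norm \<eta> = 1" "dist \<eta> \<zeta> < \<delta>" for \<eta>
    using \<delta>(2)[OF that] by (simp add: v_def)
  define h where "h z = (LINT \<eta>|circle_measure. herglotz_kernel \<eta> z * of_real (v \<eta>))" for z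
  have eq: "herglotz u z = of_real (u \<zeta>) + h z" if "norm z < 1" for z
  proof -
    have "herglotz u z = (LINT \<eta>|circle_measure. herglotz_kernel \<eta> z * of_real (u \<zeta>) + herglotz_kernel \<eta> z * of_real (v \<eta>))"
      unfolding herglotz_def v_def by (simp add: algebra_simps)
    also have "\<dots> = (LINT \<eta>|circle_measure. herglotz_kernel \<eta> z * of_real (u \<zeta>)) + h z"
      unfolding h_def using that v
      by (intro Bochner_Integration.integral_add integrable_herglotz_kernel) auto
    finally show ?thesis
      using integral_herglotz_kernel[OF that] by simp
  qed
  \<comment> \<open>Dominated convergence along sequences: points within \<open>\<delta> / 2\<close>
    of \<open>\<zeta>\<close> stay at distance at least \<open>\<delta> / 2\<close> from every
    circle point where \<open>v\<close> is nonzero, so the kernel is bounded there by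
    \<open>4 / \<delta>\<close>.\<close>
  have lim: "(h \<longlongrightarrow> h \<zeta>) (at \<zeta> within ball 0 1)"
    unfolding tendsto_at_iff_sequentially
  proof (intro allI impI)
    fix X :: "nat \<Rightarrow> complex"
    assume X: "\<forall>i. X i \<in> ball 0 1 - {\<zeta>}" "X \<longlonglongrightarrow> \<zeta>"
    obtain N where N: "\<And>i. i \<ge> N \<Longrightarrow> dist (X i) \<zeta> < \<delta> / 2"
      using X(2) \<delta>(1) unfolding lim_sequentially by (meson half_gt_zero)
    have "(\<lambda>i. h (X (i + N))) \<longlonglongrightarrow> h \<zeta>"
      unfolding h_def
    proof (rule integral_dominated_convergence)
      show "integrable circle_measure (\<lambda>\<eta>. 4 / \<delta> * \<bar>v \<eta>\<bar>)"
        using v by simp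
      show "AE \<eta> in circle_measure. (\<lambda>i. herglotz_kernel \<eta> (X (i + N)) * of_real (v \<eta>))
          \<longlonglongrightarrow> herglotz_kernel \<eta> \<zeta> * of_real (v \<eta>)"
      proof (rule AE_I2)
        fix \<eta>
        show "(\<lambda>i. herglotz_kernel \<eta> (X (i + N)) * of_real (v \<eta>))
          \<longlonglongrightarrow> herglotz_kernel \<eta> \<zeta> * of_real (v \<eta>)"
        proof (cases "\<eta> = \<zeta>")
          case False
          then show ?thesis
            unfolding herglotz_kernel_def
            by (intro tendsto_intros LIMSEQ_ignore_initial_segment[OF X(2)]) auto
        qed (simp add: v_def)
      qed
      show "AE \<eta> in circle_measure. norm (herglotz_kernel \<eta> (X (i + N)) * of_real (v \<eta>)) \<le> 4 / \<delta> * \<bar>v \<eta>\<bar>" for i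
        using AE_circle_measure_norm
      proof eventually_elim
        case (elim \<eta>)
        show ?case
        proof (cases "dist \<eta> \<zeta> < \<delta>")
          case False
          have "dist \<eta> \<zeta> \<le> dist \<eta> (X (i + N)) + dist (X (i + N)) \<zeta>"
            by (rule dist_triangle)
          then have "\<delta> / 2 \<le> norm (\<eta> - X (i + N))"
            using N[of "i + N"] False by (simp add: dist_norm)
          moreover have "norm (X (i + N)) \<le> 1"
            using X(1) by (auto simp: less_imp_le)
          ultimately have "norm (herglotz_kernel \<eta> (X (i + N))) \<le> 2 / (\<delta> / 2)"
            using elim \<delta>(1) by (intro norm_herglotz_kernel_le) auto
          then show ?thesis
            unfolding norm_mult norm_of_real by (intro mult_right_mono) auto
        qed (simp add: v0 elim)
      qed
    qed simp_all
    then show "(h \<circ> X) \<longlonglongrightarrow> h \<zeta>"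
      unfolding comp_def by (rule LIMSEQ_offset)
  qed
  \<comment> \<open>The integral also makes sense at the boundary point \<open>\<zeta>\<close>.
    There the kernel is purely imaginary on the circle, so \<open>h \<zeta>\<close> contributes
    nothing to the real part of the limit.\<close>
  have "integrable circle_measure (\<lambda>\<eta>. herglotz_kernel \<eta> \<zeta> * of_real (v \<eta>))"
  proof (rule Bochner_Integration.integrable_bound)
    show "integrable circle_measure (\<lambda>\<eta>. 2 / \<delta> * v \<eta>)"
      using v by simp
    show "AE \<eta> in circle_measure. norm (herglotz_kernel \<eta> \<zeta> * of_real (v \<eta>)) \<le> norm (2 / \<delta> * v \<eta>)"
      using AE_circle_measure_norm
    proof eventually_elim
      case (elim \<eta>)
      show ?case
      proof (cases "dist \<eta> \<zeta> < \<delta>")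
        case False
        then have "norm (herglotz_kernel \<eta> \<zeta>) \<le> 2 / \<delta>"
          using \<delta>(1) elim \<zeta> by (intro norm_herglotz_kernel_le) (auto simp: dist_norm)
        then show ?thesis
          unfolding norm_mult using \<delta>(1) by (intro mult_mono) auto
      qed (simp add: v0 elim)
    qed
  qed simp
  then have "Re (h \<zeta>) = (LINT \<eta>|circle_measure. Re (herglotz_kernel \<eta> \<zeta> * of_real (v \<eta>)))"
    unfolding h_def by (rule integral_bounded_linear[symmetric, OF bounded_linear_Re])
  also have "\<dots> = (LINT \<eta>|circle_measure. 0)"
    using AE_circle_measure_norm \<zeta>
    by (intro integral_cong_AE) (auto elim!: eventually_mono simp: Re_herglotz_kernel)
  finally have "Re (h \<zeta>) = 0"
    by simp
  moreover have "(herglotz u \<longlongrightarrow> of_real (u \<zeta>) + h \<zeta>) (at \<zeta> within ball 0 1)"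
    using lim by (subst tendsto_cong[where g = "\<lambda>z. of_real (u \<zeta>) + h z"])
      (auto intro!: tendsto_intros simp: eventually_at_filter eq)
  ultimately show ?thesis
    by (intro exI[of _ "of_real (u \<zeta>) + h \<zeta>"]) simp
qed

text \<open>Radial points \<open>(1 - s) * \<zeta>\<close> satisfy
  \<open>dist z \<zeta> = 1 - norm z\<close>, hence lie in the region as soon as
  \<open>\<alpha> > 1\<close>. This makes limits in the region unique, so that the description in
  \<open>boundary_value\<close> can be resolved.\<close>

lemma stolz_region_nontrivial:
  assumes "norm \<zeta> = 1" "\<alpha> > 1"
  shows "at \<zeta> within stolz_region \<alpha> \<zeta> \<noteq> bot"
proof -
  have "\<zeta> islimpt stolz_region \<alpha> \<zeta>"
    unfolding islimpt_approachable
  proof (intro allI impI)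
    fix e :: real
    assume "e > 0"
    \<comment> \<open>The bound \<open>1 / 2\<close> keeps the factor \<open>1 - s\<close> positive,
      the bound \<open>e / 2\<close> keeps the point within \<open>e\<close>.\<close>
    define s where "s = min (e / 2) (1 / 2)"
    define z where "z = of_real (1 - s) * \<zeta>"
    have s: "0 < s" "s < e" "s < 1"
      using \<open>e > 0\<close> by (auto simp: s_def)
    have n: "norm z = 1 - s"
      using s assms(1) by (simp only: z_def norm_mult norm_of_real) simp
    have "z - \<zeta> = of_real (- s) * \<zeta>"
      by (simp add: z_def algebra_simps)
    then have d: "dist z \<zeta> = s"
      using s assms(1) by (simp only: dist_norm norm_mult norm_of_real)
    show "\<exists>x'\<in>stolz_region \<alpha> \<zeta>. x' \<noteq> \<zeta> \<and> dist x' \<zeta> < e"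
      using s n d assms by (intro bexI[of _ z]) (auto simp: stolz_region_def)
  qed
  then show ?thesis
    by (simp add: trivial_limit_within)
qed

lemma boundary_value_eqI:
  assumes "norm \<zeta> = 1" "has_nontangential_limit f L \<zeta>"
  shows "boundary_value f \<zeta> = L"
  unfolding boundary_value_def
proof (rule the_equality)
  fix L'
  assume "has_nontangential_limit f L' \<zeta>"
  then have "(f \<longlongrightarrow> L') (at \<zeta> within stolz_region 2 \<zeta>)" "(f \<longlongrightarrow> L) (at \<zeta> within stolz_region 2 \<zeta>)"
    using assms(2) by (auto simp: has_nontangential_limit_def)
  then show "L' = L"
    using tendsto_unique[OF stolz_region_nontrivial[OF assms(1)]] by force
qed (fact assms(2))

lemma norm_boundary_value_outer:
  assumes "u \<in> borel_measurable borel" "integrable circle_measure u"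
    and \<zeta>: "norm \<zeta> = 1" and "locally_const_at u \<zeta>"
  shows "norm (boundary_value (outer_function u) \<zeta>) = exp (u \<zeta>)"
proof -
  obtain L where L: "Re L = u \<zeta>" "(herglotz u \<longlongrightarrow> L) (at \<zeta> within ball 0 1)"
    using herglotz_tendsto[OF assms] by blast
  have "(outer_function u \<longlongrightarrow> exp L) (at \<zeta> within ball 0 1)"
    unfolding outer_function_def by (intro tendsto_intros L)
  then have "has_nontangential_limit (outer_function u) (exp L) \<zeta>"
    unfolding has_nontangential_limit_def stolz_region_def
    by (intro allI impI) (rule tendsto_within_subset, auto)
  then have "boundary_value (outer_function u) \<zeta> = exp L"
    by (rule boundary_value_eqI[OF \<zeta>])
  then show ?thesis
    using L(1) by simp
qed

lemma AE_norm_boundary_value_outer: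
  assumes "u \<in> borel_measurable borel" "integrable circle_measure u"
    and "AE \<zeta> in circle_measure. locally_const_at u \<zeta>"
  shows "AE \<zeta> in circle_measure. norm (boundary_value (outer_function u) \<zeta>) = exp (u \<zeta>)"
  using AE_circle_measure_norm assms(3)
  by eventually_elim (rule norm_boundary_value_outer[OF assms(1,2)])

text \<open>For \<open>u \<ge> 0\<close> the positive part in \<open>log_plus\<close> does nothing, so the integral is the mean of a
  harmonic function and does not depend on \<open>r\<close>.\<close>
lemma log_plus_norm_outer_mean:
  assumes [measurable]: "u \<in> borel_measurable borel" and u: "integrable circle_measure u" "\<And>\<zeta>. 0 \<le> u \<zeta>"
    and r: "0 \<le> r" "r < 1"
  shows "(\<integral>\<^sup>+ \<zeta>. ennreal (log_plus (norm (outer_function u (of_real r * \<zeta>)))) \<partial>circle_measure)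
    = ennreal (LINT \<zeta>|circle_measure. u \<zeta>)"
proof -
  note mean = integral_circle_measure_holomorphic[OF herglotz_measurable herglotz_holomorphic, of u r, OF assms(1,1) u(1) r]
  have nonneg: "AE \<zeta> in circle_measure. 0 \<le> Re (herglotz u (of_real r * \<zeta>))"
    using AE_circle_measure_norm
    by eventually_elim (use assms in \<open>auto intro!: Re_herglotz_nonneg simp: norm_mult\<close>)
  have "(\<integral>\<^sup>+ \<zeta>. ennreal (log_plus (norm (outer_function u (of_real r * \<zeta>)))) \<partial>circle_measure)
     = (\<integral>\<^sup>+ \<zeta>. ennreal (Re (herglotz u (of_real r * \<zeta>))) \<partial>circle_measure)"
    using nonneg by (intro nn_integral_cong_AE) (auto elim!: eventually_mono simp: log_plus_def outer_function_def)
  also have "\<dots> = ennreal (LINT \<zeta>|circle_measure. Re (herglotz u (of_real r * \<zeta>)))"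
    using nonneg mean(1) by (intro nn_integral_eq_integral integrable_bounded_linear[OF bounded_linear_Re])
  also have "(LINT \<zeta>|circle_measure. Re (herglotz u (of_real r * \<zeta>))) = Re (herglotz u 0)"
    unfolding mean(2)[symmetric] by (rule integral_bounded_linear[OF bounded_linear_Re mean(1)])
  finally show ?thesis
    by (simp add: herglotz_0)
qed

text \<open>The \<open>log_plus\<close> means over all radii below 1 equal the integral of
  \<open>u\<close>, and so does the boundary integral. The supremum is therefore finite and the
  limit is that of a constant.\<close>

lemma outer_function_smirnov:
  assumes u: "u \<in> borel_measurable borel" "integrable circle_measure u" "\<And>\<zeta>. 0 \<le> u \<zeta>"
    and "AE \<zeta> in circle_measure. locally_const_at u \<zeta>"
  shows "outer_function u \<in> smirnov_class"
proof -
  note mean = log_plus_norm_outer_mean[OF u]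
  have "outer_function u holomorphic_on ball 0 1"
    unfolding outer_function_def by (intro holomorphic_intros herglotz_holomorphic u)
  moreover have "(SUP r\<in>{0..<1}. \<integral>\<^sup>+ \<zeta>. ennreal (log_plus (norm (outer_function u (of_real r * \<zeta>)))) \<partial>circle_measure)
      \<le> ennreal (LINT \<zeta>|circle_measure. u \<zeta>)"
    by (rule SUP_least) (simp add: mean)
  then have "(SUP r\<in>{0..<1}. \<integral>\<^sup>+ \<zeta>. ennreal (log_plus (norm (outer_function u (of_real r * \<zeta>)))) \<partial>circle_measure) < \<infinity>"
    by (rule le_less_trans) simp
  moreover have "((\<lambda>r. \<integral>\<^sup>+ \<zeta>. ennreal (log_plus (norm (outer_function u (of_real r * \<zeta>)))) \<partial>circle_measure)
       \<longlongrightarrow> (\<integral>\<^sup>+ \<zeta>. ennreal (log_plus (norm (boundary_value (outer_function u) \<zeta>))) \<partial>circle_measure)) (at_left (1::real))"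
  proof -
    have "(\<integral>\<^sup>+ \<zeta>. ennreal (log_plus (norm (boundary_value (outer_function u) \<zeta>))) \<partial>circle_measure)
        = (\<integral>\<^sup>+ \<zeta>. ennreal (u \<zeta>) \<partial>circle_measure)"
      using AE_norm_boundary_value_outer[OF u(1,2) assms(4)] u(3)
      by (intro nn_integral_cong_AE) (auto elim!: eventually_mono simp: log_plus_def)
    also have "\<dots> = ennreal (LINT \<zeta>|circle_measure. u \<zeta>)"
      using u by (intro nn_integral_eq_integral) auto
    finally have bv: "(\<integral>\<^sup>+ \<zeta>. ennreal (log_plus (norm (boundary_value (outer_function u) \<zeta>))) \<partial>circle_measure)
        = ennreal (LINT \<zeta>|circle_measure. u \<zeta>)" .
    have "eventually (\<lambda>r. r \<in> {0<..<1}) (at_left (1::real))"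
      by (rule eventually_at_left_real) simp
    then have "eventually (\<lambda>r. (\<integral>\<^sup>+ \<zeta>. ennreal (log_plus (norm (outer_function u (of_real r * \<zeta>)))) \<partial>circle_measure)
        = ennreal (LINT \<zeta>|circle_measure. u \<zeta>)) (at_left (1::real))"
      by eventually_elim (simp add: mean)
    then show ?thesis
      unfolding bv by (rule tendsto_eventually)
  qed
  ultimately show ?thesis
    by (simp add: smirnov_class_def nevanlinna_class_def)
qed

text \<open>Linearity of the Herglotz integral under \<open>exp\<close>; it makes the product of the
  two functions of the counterexample outer again.\<close>

lemma outer_function_add:
  assumes "u \<in> borel_measurable borel" "integrable circle_measure u"
    and "v \<in> borel_measurable borel" "integrable circle_measure v" and z: "norm z < 1"
  shows "outer_function (\<lambda>\<zeta>. u \<zeta> + v \<zeta>) z = outer_function u z * outer_function v z"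
proof -
  have "herglotz (\<lambda>\<zeta>. u \<zeta> + v \<zeta>) z = herglotz u z + herglotz v z"
    unfolding herglotz_def of_real_add distrib_left
    by (intro Bochner_Integration.integral_add integrable_herglotz_kernel assms)
  then show ?thesis
    by (simp add: outer_function_def exp_add)
qed

text \<open>Stolz regions lie in the open disk, where alone the product formula for outer functions
  is available.\<close>

lemma boundary_value_cong:
  assumes "\<And>z. norm z < 1 \<Longrightarrow> f z = g z"
  shows "boundary_value f \<zeta> = boundary_value g \<zeta>"
proof -
  have "(f \<longlongrightarrow> L) (at \<zeta> within stolz_region \<alpha> \<zeta>) \<longleftrightarrow> (g \<longlongrightarrow> L) (at \<zeta> within stolz_region \<alpha> \<zeta>)" for L \<alpha>
    using assms by (intro tendsto_cong) (auto simp: eventually_at_filter stolz_region_def)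
  then show ?thesis
    by (simp add: boundary_value_def has_nontangential_limit_def)
qed

subsection \<open>Step functions on countably many arcs\<close>

text \<open>The label \<open>k \<zeta>\<close> is the index of the arc containing
  \<open>\<zeta>\<close>, and \<open>m n\<close> is the mass of the \<open>n\<close>-th arc. With
  labels instead of a family of sets, a step function is simply a composition
  \<open>c (k \<zeta>)\<close>.\<close>

locale circle_partition =
  fixes k :: "complex \<Rightarrow> nat" and m :: "nat \<Rightarrow> real"
  assumes measurable_label [measurable]: "k \<in> borel \<rightarrow>\<^sub>M count_space UNIV"
    and weight_nonneg: "0 \<le> m n"
    and emeasure_label: "emeasure circle_measure {\<zeta>. k \<zeta> = n} = ennreal (m n)"
    and AE_locally_const: "AE \<zeta> in circle_measure. locally_const_at k \<zeta>"
begin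

lemma measurable_comp_label [measurable]: "(\<lambda>\<zeta>. f (k \<zeta>)) \<in> borel_measurable borel"
  by (rule measurable_compose[OF measurable_label]) simp

lemma nn_integral_comp_label:
  fixes F :: "nat \<Rightarrow> ennreal"
  shows "(\<integral>\<^sup>+ \<zeta>. F (k \<zeta>) \<partial>circle_measure) = (\<Sum>n. F n * ennreal (m n))"
proof -
  have [measurable]: "{\<zeta>. k \<zeta> = n} \<in> sets borel" for n
    by measurable
  have "F (k \<zeta>) = (\<Sum>n. F n * indicator {\<zeta>. k \<zeta> = n} \<zeta>)" for \<zeta>
    by (subst suminf_finite[of "{k \<zeta>}"]) auto
  then have "(\<integral>\<^sup>+ \<zeta>. F (k \<zeta>) \<partial>circle_measure)
      = (\<integral>\<^sup>+ \<zeta>. (\<Sum>n. F n * indicator {\<zeta>. k \<zeta> = n} \<zeta>) \<partial>circle_measure)"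
    by simp
  also have "\<dots> = (\<Sum>n. \<integral>\<^sup>+ \<zeta>. F n * indicator {\<zeta>. k \<zeta> = n} \<zeta> \<partial>circle_measure)"
    by (rule nn_integral_suminf) simp
  also have "\<dots> = (\<Sum>n. F n * ennreal (m n))"
    by (simp add: nn_integral_cmult_indicator emeasure_label)
  finally show ?thesis .
qed

lemma integrable_comp_label:
  fixes c :: "nat \<Rightarrow> real"
  assumes "\<And>n. 0 \<le> c n" "summable (\<lambda>n. c n * m n)"
  shows "integrable circle_measure (\<lambda>\<zeta>. c (k \<zeta>))"
proof (rule integrableI_nonneg)
  have "(\<integral>\<^sup>+ \<zeta>. ennreal (c (k \<zeta>)) \<partial>circle_measure) = (\<Sum>n. ennreal (c n * m n))"
    by (simp add: nn_integral_comp_label[of "\<lambda>n. ennreal (c n)"] ennreal_mult' assms(1))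
  also have "\<dots> = ennreal (\<Sum>n. c n * m n)"
    using assms weight_nonneg by (intro suminf_ennreal2) auto
  finally show "(\<integral>\<^sup>+ \<zeta>. ennreal (c (k \<zeta>)) \<partial>circle_measure) < \<infinity>"
    by simp
qed (use assms in auto)

lemma AE_locally_const_comp: "AE \<zeta> in circle_measure. locally_const_at (\<lambda>\<zeta>. c (k \<zeta>)) \<zeta>"
  using AE_locally_const by eventually_elim (rule locally_const_at_comp)

lemma outer_function_smirnov_label:
  fixes c :: "nat \<Rightarrow> real"
  assumes "\<And>n. 0 \<le> c n" "summable (\<lambda>n. c n * m n)"
  shows "outer_function (\<lambda>\<zeta>. c (k \<zeta>)) \<in> smirnov_class"
  by (intro outer_function_smirnov integrable_comp_label AE_locally_const_comp assms) auto

text \<open>The boundary modulus is \<open>exp (c n)\<close> on the \<open>n\<close>-th arc and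
  \<open>comp_log\<close> undoes the exponential. One formula thus evaluates the Orlicz integrals of
  both factors and of their product.\<close>

lemma nn_integral_boundary_value_outer:
  fixes c :: "nat \<Rightarrow> real"
  assumes "\<And>n. 0 \<le> c n" "summable (\<lambda>n. c n * m n)"
  shows "(\<integral>\<^sup>+ \<zeta>. ennreal (comp_log \<phi> (norm (boundary_value (outer_function (\<lambda>\<zeta>. c (k \<zeta>))) \<zeta>))) \<partial>circle_measure)
    = (\<Sum>n. ennreal (\<phi> (c n) * m n))"
proof -
  have "AE \<zeta> in circle_measure. norm (boundary_value (outer_function (\<lambda>\<zeta>. c (k \<zeta>))) \<zeta>) = exp (c (k \<zeta>))"
    by (intro AE_norm_boundary_value_outer integrable_comp_label AE_locally_const_comp assms) auto
  then have "(\<integral>\<^sup>+ \<zeta>. ennreal (comp_log \<phi> (norm (boundary_value (outer_function (\<lambda>\<zeta>. c (k \<zeta>))) \<zeta>))) \<partial>circle_measure)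
    = (\<integral>\<^sup>+ \<zeta>. ennreal (\<phi> (c (k \<zeta>))) \<partial>circle_measure)"
    by (intro nn_integral_cong_AE) (auto elim!: eventually_mono simp: comp_log_def)
  then show ?thesis
    by (simp add: nn_integral_comp_label[of "\<lambda>n. ennreal (\<phi> (c n))"] ennreal_mult'' weight_nonneg)
qed

lemma outer_function_in_hardy_orlicz:
  fixes c :: "nat \<Rightarrow> real"
  assumes "\<And>n. 0 \<le> c n" "summable (\<lambda>n. c n * m n)"
    and "\<And>n. 0 \<le> \<phi> (c n)" "summable (\<lambda>n. \<phi> (c n) * m n)"
  shows "outer_function (\<lambda>\<zeta>. c (k \<zeta>)) \<in> hardy_orlicz (comp_log \<phi>)"
proof -
  have "(\<Sum>n. ennreal (\<phi> (c n) * m n)) = ennreal (\<Sum>n. \<phi> (c n) * m n)"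
    using assms weight_nonneg by (intro suminf_ennreal2) auto
  then show ?thesis
    using outer_function_smirnov_label[OF assms(1,2)]
    by (simp add: hardy_orlicz_def nn_integral_boundary_value_outer[OF assms(1,2)])
qed

end

text \<open>Consecutive half-open arcs are laid out counterclockwise from angle 0, with breakpoints
  at \<open>2 * pi\<close> times the partial sums of \<open>m\<close>. The label is constant near
  every point that is not a breakpoint.\<close>

lemma circle_partition_exists:
  fixes m :: "nat \<Rightarrow> real"
  assumes pos: "\<And>n. 0 < m n" and sums: "m sums 1"
  shows "\<exists>k. circle_partition k m"
proof -
  define s where "s n = (\<Sum>i<n. m i)" for n
  have s_Suc: "s (Suc n) = s n + m n" for n
    by (simp add: s_def)
  have s_mono: "s i \<le> s j" if "i \<le> j" for i j
    unfolding s_def using that pos by (intro sum_mono2) (auto simp: less_imp_le)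
  have s_lim: "s \<longlonglongrightarrow> 1"
    using sums by (simp add: sums_def s_def[abs_def])
  have s_le: "s n \<le> 1" for n
    using s_mono by (intro incseq_le[OF _ s_lim]) (auto simp: incseq_def)
  have s_nonneg: "0 \<le> s n" for n
    unfolding s_def using pos by (intro sum_nonneg) (simp add: less_imp_le)
  define k where "k \<zeta> = (LEAST n. Arg2pi \<zeta> < 2 * pi * s (Suc n))" for \<zeta>
  have k_eq: "k \<zeta> = n \<longleftrightarrow> 2 * pi * s n \<le> Arg2pi \<zeta> \<and> Arg2pi \<zeta> < 2 * pi * s (Suc n)" for \<zeta> n
  proof
    \<comment> \<open>The least index exists because \<open>Arg2pi \<zeta>\<close> is strictly below
      \<open>2 * pi\<close> while the partial sums tend to 1.\<close>
    have "eventually (\<lambda>n. Arg2pi \<zeta> / (2 * pi) < s n) sequentially"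
      using Arg2pi[of \<zeta>] by (intro order_tendstoD[OF s_lim]) (simp add: field_simps)
    then obtain N where "Arg2pi \<zeta> / (2 * pi) < s (Suc N)"
      unfolding eventually_sequentially by (metis le_SucI order_refl)
    then have "\<exists>n. Arg2pi \<zeta> < 2 * pi * s (Suc n)"
      by (auto simp: field_simps)
    then have *: "Arg2pi \<zeta> < 2 * pi * s (Suc (k \<zeta>))"
      unfolding k_def by (rule LeastI_ex)
    have **: "2 * pi * s (k \<zeta>) \<le> Arg2pi \<zeta>"
    proof (cases "k \<zeta>")
      case 0
      then show ?thesis
        using Arg2pi[of \<zeta>] by (simp add: s_def)
    next
      case (Suc j)
      then have "\<not> Arg2pi \<zeta> < 2 * pi * s (Suc j)"
        unfolding k_def by (intro not_less_Least) simp
      then show ?thesis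
        by (simp add: Suc)
    qed
    show "2 * pi * s n \<le> Arg2pi \<zeta> \<and> Arg2pi \<zeta> < 2 * pi * s (Suc n)" if "k \<zeta> = n"
      using * ** that by simp
    show "k \<zeta> = n" if n: "2 * pi * s n \<le> Arg2pi \<zeta> \<and> Arg2pi \<zeta> < 2 * pi * s (Suc n)"
    proof (rule ccontr)
      assume "k \<zeta> \<noteq> n"
      then consider "Suc (k \<zeta>) \<le> n" | "Suc n \<le> k \<zeta>"
        by linarith
      then show False
      proof cases
        case 1
        then have "2 * pi * s (Suc (k \<zeta>)) \<le> 2 * pi * s n"
          by (simp add: s_mono)
        then show False
          using * n by linarith
      next
        case 2
        then have "2 * pi * s (Suc n) \<le> 2 * pi * s (k \<zeta>)"
          by (simp add: s_mono)
        then show False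
          using ** n by linarith
      qed
    qed
  qed
  have level [measurable]: "{\<zeta>. k \<zeta> = n} \<in> sets borel" for n
    unfolding k_eq by measurable
  have "circle_partition k m"
  proof
    show "k \<in> borel \<rightarrow>\<^sub>M count_space UNIV"
      by (subst measurable_count_space_eq_countable) (auto simp: vimage_def level)
    show "0 \<le> m n" for n
      using pos[of n] by simp
    show "emeasure circle_measure {\<zeta>. k \<zeta> = n} = ennreal (m n)" for n
    proof -
      define a b where "a = 2 * pi * s n" and "b = 2 * pi * s (Suc n)"
      have ab: "0 \<le> a" "a \<le> b" "b \<le> 2 * pi"
        using s_nonneg[of n] s_mono[of n "Suc n"] s_le[of "Suc n"] by (auto simp: a_def b_def)
      have ba: "b - a = 2 * pi * m n"
        by (simp add: a_def b_def s_Suc algebra_simps)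
      have "k \<zeta> = n \<longleftrightarrow> a \<le> Arg2pi \<zeta> \<and> Arg2pi \<zeta> < b" for \<zeta>
        by (simp add: k_eq a_def b_def)
      then have "{0..<2 * pi} \<inter> cis -` {\<zeta>. k \<zeta> = n} = {a..<b}"
        using ab by (auto simp: Arg2pi_cis dest: order_less_le_trans)
      then show ?thesis
        using ab(2) pos[of n] by (simp add: emeasure_circle_measure ba divide_ennreal)
    qed
    \<comment> \<open>The exceptional set consists of the breakpoints, among them 1, where
      \<open>Arg2pi\<close> jumps and the arcs accumulate.\<close>
    define N where "N = insert 1 (range (\<lambda>n. cis (2 * pi * s n)))"
    have "AE \<zeta> in circle_measure. \<zeta> \<notin> N"
      by (rule AE_circle_measure_not_in_countable) (simp add: N_def)
    with AE_circle_measure_norm show "AE \<zeta> in circle_measure. locally_const_at k \<zeta>"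
    proof eventually_elim
      case (elim \<zeta>)
      have cis: "cis (Arg2pi \<zeta>) = \<zeta>"
        using elim(1) by (simp add: complex_norm_eq_1_exp cis_conv_exp)
      have "Arg2pi \<zeta> \<noteq> 2 * pi * s n" for n
      proof
        assume "Arg2pi \<zeta> = 2 * pi * s n"
        then have "\<zeta> \<in> N"
          using cis by (auto simp: N_def intro!: image_eqI[of _ _ n])
        then show False
          using elim(2) by simp
      qed
      moreover have "2 * pi * s (k \<zeta>) \<le> Arg2pi \<zeta> \<and> Arg2pi \<zeta> < 2 * pi * s (Suc (k \<zeta>))"
        using k_eq by blast
      ultimately have I: "2 * pi * s (k \<zeta>) < Arg2pi \<zeta>" "Arg2pi \<zeta> < 2 * pi * s (Suc (k \<zeta>))"
        by (metis order_le_less)+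
      \<comment> \<open>The nonnegative real axis meets the circle only at 1, which lies in
        \<open>N\<close>; off this ray \<open>Arg2pi\<close> is continuous.\<close>
      have "\<zeta> \<notin> \<real>\<^sub>\<ge>\<^sub>0"
        using elim by (auto simp: N_def nonneg_Reals_def)
      then have "isCont Arg2pi \<zeta>"
        by (rule continuous_at_Arg2pi)
      then have "eventually (\<lambda>\<eta>. 2 * pi * s (k \<zeta>) < Arg2pi \<eta> \<and> Arg2pi \<eta> < 2 * pi * s (Suc (k \<zeta>))) (nhds \<zeta>)"
        unfolding continuous_within tendsto_at_iff_tendsto_nhds
        by (intro eventually_conj order_tendstoD) (use I in auto)
      then have "eventually (\<lambda>\<eta>. k \<eta> = k \<zeta>) (nhds \<zeta>)"
        by eventually_elim (simp add: k_eq)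
      then show ?case
        unfolding locally_const_at_def eventually_nhds_metric by blast
    qed
  qed
  then show ?thesis
    by blast
qed

section \<open>Growth of concave functions and unbounded ratios\<close>

text \<open>Concavity is used at 1 as a convex combination of 0 and \<open>t\<close> with weight
  \<open>1 / t\<close> on \<open>t\<close>, then solved for \<open>f t\<close>. The bound transfers
  summability from the data of \<open>f\<close> to those of \<open>g\<close>.\<close>

lemma concave_on_le_linear:
  fixes f :: "real \<Rightarrow> real"
  assumes "concave_on UNIV f" "1 \<le> t"
  shows "f t \<le> (\<bar>f 0\<bar> + \<bar>f 1\<bar>) * t"
proof -
  have "convex_on UNIV (\<lambda>x. - f x)"
    using assms(1) by (simp add: concave_on_def)
  from convex_onD[OF this, of "1 / t" 0 t] have "f 1 \<ge> (1 - 1 / t) * f 0 + 1 / t * f t"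
    using assms(2) by (simp add: algebra_simps)
  then have "t * f 1 \<ge> t * ((1 - 1 / t) * f 0 + 1 / t * f t)"
    using assms(2) by (intro mult_left_mono) auto
  also have "t * ((1 - 1 / t) * f 0 + 1 / t * f t) = (t - 1) * f 0 + f t"
    using assms(2) by (simp add: field_simps)
  finally have "f t \<le> t * f 1 + (t - 1) * (- f 0)"
    by (simp add: algebra_simps)
  also have "\<dots> \<le> t * \<bar>f 1\<bar> + (t - 1) * \<bar>f 0\<bar>"
    using assms(2) by (intro add_mono mult_left_mono) auto
  also have "\<dots> \<le> t * \<bar>f 1\<bar> + t * \<bar>f 0\<bar>"
    by (intro add_left_mono mult_right_mono) auto
  finally show ?thesis
    by (simp add: algebra_simps)
qed

text \<open>An eventual bound by \<open>C\<close> would bound the limit superior. The free threshold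
  \<open>T\<close> allows the values \<open>t n\<close> to be taken where all other growth
  conditions hold.\<close>

lemma Limsup_at_top_eq_infinity_frequently:
  fixes f :: "real \<Rightarrow> real"
  assumes "Limsup at_top (\<lambda>t. ereal (f t)) = \<infinity>"
  shows "\<exists>t\<ge>T. C < f t"
proof (rule ccontr)
  assume "\<not> ?thesis"
  then have "eventually (\<lambda>t. ereal (f t) \<le> ereal C) at_top"
    by (auto simp: eventually_at_top_linorder not_less)
  then have "Limsup at_top (\<lambda>t. ereal (f t)) \<le> ereal C"
    by (rule Limsup_bounded)
  then show False
    using assms by simp
qed

section \<open>Construction of the counterexample\<close>

theorem proposition3p3:
  fixes \<phi> \<gamma> :: "real \<Rightarrow> real"
  assumes "strongly_convex \<phi>"
    and "concave_on UNIV \<gamma>"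
    and "strict_mono \<gamma>"
    and "filterlim \<gamma> at_top at_top"
    and "Limsup at_top (\<lambda>t. ereal (\<phi> (t + \<gamma> t) / \<phi> t)) = \<infinity>"
  shows "\<exists>g \<in> hardy_orlicz (comp_log (\<phi> \<circ> inv \<gamma>)).
           g \<notin> multipliers (hardy_orlicz (comp_log \<phi>))"
proof -
  have \<phi>: "\<And>t. 0 \<le> \<phi> t" "filterlim (\<lambda>t. \<phi> t / t) at_top at_top"
    using assms(1) by (auto simp: strongly_convex_def)
  \<comment> \<open>Beyond \<open>T\<close>, nonnegativity of \<open>t\<close> and
    \<open>\<gamma> t\<close> gives admissible data for outer functions,
    \<open>t \<le> \<phi> t\<close> makes the data of \<open>f\<close> integrable, and
    \<open>1 \<le> \<phi> t\<close> allows division by \<open>\<phi> t\<close>.\<close>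
  have "eventually (\<lambda>t. 1 \<le> \<phi> t / t \<and> 0 \<le> \<gamma> t \<and> 1 \<le> t) at_top"
    using \<phi>(2) assms(4) by (intro eventually_conj eventually_ge_at_top) (auto simp: filterlim_at_top)
  then obtain T where T: "\<And>t. T \<le> t \<Longrightarrow> 1 \<le> \<phi> t / t \<and> 0 \<le> \<gamma> t \<and> 1 \<le> t"
    unfolding eventually_at_top_linorder by blast
  have "\<forall>n. \<exists>t. T \<le> t \<and> 2 ^ Suc n < \<phi> (t + \<gamma> t) / \<phi> t"
    using Limsup_at_top_eq_infinity_frequently[OF assms(5)] by blast
  then obtain t where t: "\<And>n. T \<le> t n" "\<And>n. 2 ^ Suc n < \<phi> (t n + \<gamma> (t n)) / \<phi> (t n)"
    by metis
  have t1: "1 \<le> t n" and \<gamma>t: "0 \<le> \<gamma> (t n)" and \<phi>t: "t n \<le> \<phi> (t n)" for n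
    using T[OF t(1)[of n]] by (auto simp: field_simps)
  have \<phi>1: "1 \<le> \<phi> (t n)" for n
    using t1[of n] \<phi>t[of n] by simp
  \<comment> \<open>The weights turn \<open>\<phi> (t n) * w n\<close> into a geometric sequence.
    Dividing by their sum \<open>S\<close> gives total mass 1, that of the circle.\<close>
  define w where "w n = (1 / 2) ^ Suc n / \<phi> (t n)" for n
  have w_pos: "0 < w n" for n
    using \<phi>1[of n] by (simp add: w_def)
  have geom: "summable (\<lambda>n. (1 / 2 :: real) ^ Suc n)"
    using summable_geometric[of "1 / 2 :: real"] by (simp only: summable_Suc_iff) simp
  have "summable w"
  proof (rule summable_comparison_test'[OF geom])
    show "norm (w n) \<le> (1 / 2) ^ Suc n" for n
      using \<phi>1[of n] w_pos[of n] by (simp add: w_def field_simps)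
  qed
  define S where "S = suminf w"
  have "S > 0"
    unfolding S_def using \<open>summable w\<close> w_pos by (rule suminf_pos)
  define m where "m n = w n / S" for n
  have m_pos: "0 < m n" for n
    using w_pos \<open>S > 0\<close> by (simp add: m_def)
  have "m sums 1"
    using sums_divide[OF summable_sums[OF \<open>summable w\<close>], of S] \<open>S > 0\<close>
    by (simp add: m_def[abs_def] S_def)
  then obtain k where "circle_partition k m"
    using circle_partition_exists m_pos by blast
  then interpret circle_partition k m .
  have \<phi>m: "\<phi> (t n) * m n = (1 / 2) ^ Suc n / S" for n
    using \<phi>1[of n] by (simp add: m_def w_def)
  have sum_\<phi>: "summable (\<lambda>n. \<phi> (t n) * m n)"
    unfolding \<phi>m by (rule summable_divide[OF geom])
  have sum_t: "summable (\<lambda>n. t n * m n)"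
  proof (rule summable_comparison_test'[OF sum_\<phi>])
    show "norm (t n * m n) \<le> \<phi> (t n) * m n" for n
      using mult_right_mono[OF \<phi>t[of n], of "m n"] t1[of n] m_pos[of n] by (simp add: abs_mult)
  qed
  \<comment> \<open>The slope from the linear bound on \<open>\<gamma>\<close>; it compares the data
    of \<open>g\<close> with those of \<open>f\<close>, whose sum converges.\<close>
  define C where "C = \<bar>\<gamma> 0\<bar> + \<bar>\<gamma> 1\<bar>"
  have sum_\<gamma>: "summable (\<lambda>n. \<gamma> (t n) * m n)"
  proof (rule summable_comparison_test'[OF summable_mult[OF sum_t, of C]])
    show "norm (\<gamma> (t n) * m n) \<le> C * (t n * m n)" for n
      using mult_right_mono[OF concave_on_le_linear[OF assms(2) t1[of n]], of "m n"] \<gamma>t[of n] m_pos[of n]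
      by (simp add: C_def abs_mult mult_ac)
  qed
  define f where "f = outer_function (\<lambda>\<zeta>. t (k \<zeta>))"
  define g where "g = outer_function (\<lambda>\<zeta>. \<gamma> (t (k \<zeta>)))"
  have t0: "0 \<le> t n" for n
    using t1[of n] by simp
  have inv: "inv \<gamma> (\<gamma> x) = x" for x
    using assms(3) by (simp add: strict_mono_imp_inj_on)
  have f: "f \<in> hardy_orlicz (comp_log \<phi>)"
    unfolding f_def by (intro outer_function_in_hardy_orlicz t0 sum_t sum_\<phi> \<phi>)
  \<comment> \<open>Since \<open>inv \<gamma>\<close> cancels \<open>\<gamma>\<close>, the Orlicz
    integral of \<open>g\<close> is the same series as that of \<open>f\<close>.\<close>
  have g: "g \<in> hardy_orlicz (comp_log (\<phi> \<circ> inv \<gamma>))"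
    unfolding g_def
    by (rule outer_function_in_hardy_orlicz[where c = "\<lambda>n. \<gamma> (t n)"])
      (simp_all add: \<gamma>t sum_\<gamma> inv sum_\<phi> \<phi>(1))
  have "(\<lambda>z. g z * f z) \<notin> hardy_orlicz (comp_log \<phi>)"
  proof
    assume "(\<lambda>z. g z * f z) \<in> hardy_orlicz (comp_log \<phi>)"
    moreover have "boundary_value (\<lambda>z. g z * f z) = boundary_value (outer_function (\<lambda>\<zeta>. t (k \<zeta>) + \<gamma> (t (k \<zeta>))))"
    proof
      fix \<zeta>
      have "integrable circle_measure (\<lambda>\<zeta>. t (k \<zeta>))" "integrable circle_measure (\<lambda>\<zeta>. \<gamma> (t (k \<zeta>)))"
        using integrable_comp_label[OF t0 sum_t] integrable_comp_label[OF \<gamma>t sum_\<gamma>] .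
      then show "boundary_value (\<lambda>z. g z * f z) \<zeta> = boundary_value (outer_function (\<lambda>\<zeta>. t (k \<zeta>) + \<gamma> (t (k \<zeta>)))) \<zeta>"
        by (intro boundary_value_cong) (simp add: f_def g_def outer_function_add)
    qed
    moreover have "(\<integral>\<^sup>+ \<zeta>. ennreal (comp_log \<phi> (norm (boundary_value (outer_function (\<lambda>\<zeta>. t (k \<zeta>) + \<gamma> (t (k \<zeta>)))) \<zeta>))) \<partial>circle_measure)
        = (\<Sum>n. ennreal (\<phi> (t n + \<gamma> (t n)) * m n))"
      using summable_add[OF sum_t sum_\<gamma>] t0 \<gamma>t
      by (intro nn_integral_boundary_value_outer[where c = "\<lambda>n. t n + \<gamma> (t n)"]) (auto simp: distrib_right)
    ultimately have "(\<Sum>n. ennreal (\<phi> (t n + \<gamma> (t n)) * m n)) \<noteq> top"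
      by (auto simp: hardy_orlicz_def)
    then have "summable (\<lambda>n. \<phi> (t n + \<gamma> (t n)) * m n)"
      using \<phi>(1) weight_nonneg by (intro summable_suminf_not_top) auto
    then have "(\<lambda>n. \<phi> (t n + \<gamma> (t n)) * m n) \<longlonglongrightarrow> 0"
      by (rule summable_LIMSEQ_zero)
    \<comment> \<open>The growth factor \<open>2 ^ Suc n\<close> from the choice of
      \<open>t n\<close> exactly cancels the decay of \<open>\<phi> (t n) * m n\<close>, so the
      terms stay above a positive constant and cannot tend to 0.\<close>
    moreover have "1 / S \<le> \<phi> (t n + \<gamma> (t n)) * m n" for n
    proof -
      have "1 / S = 2 ^ Suc n * (\<phi> (t n) * m n)"
        unfolding \<phi>m by (simp add: field_simps)
      also have "\<dots> = (2 ^ Suc n * \<phi> (t n)) * m n"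
        by simp
      also have "2 ^ Suc n * \<phi> (t n) \<le> \<phi> (t n + \<gamma> (t n))"
        using t(2)[of n] \<phi>1[of n] by (simp add: field_simps)
      finally show ?thesis
        using m_pos[of n] by (simp add: mult_right_mono)
    qed
    ultimately have "1 / S \<le> 0"
      by (intro LIMSEQ_le_const) auto
    then show False
      using \<open>S > 0\<close> by simp
  qed
  then have "g \<notin> multipliers (hardy_orlicz (comp_log \<phi>))"
    using f by (auto simp: multipliers_def)
  with g show ?thesis
    by blast
qed

end
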